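(* Let $a<b$ be real numbers, and let $X$ be a random variable with values in $[a,b]$ and probability density function $f:[a,b]\to[0,\infty)$. If $f$ is monotonically increasing (nondecreasing) on $[a,b]$, then for any $x\in(a,b)$ $$\frac12\left[(b-x)^2f_+(x)-(x-a)^2f_-(x)\right]+x\le E(X)\le\frac12\left[(b-x)^2f_-(b)-(x-a)^2f_+(a)\right]+x .$$ The constant $\frac12$ is sharp in both inequalities: in the first it cannot be replaced by a larger constant, and in the second it cannot be replaced by a smaller constant (so that the inequality holds for all such $f$ and $x$). The second inequality also holds for $x=a$ or $x=b$.
   Context: $f_+(\alpha)=\lim_{t\to\alpha^+}f(t)$ and $f_-(\alpha)=\lim_{t\to\alpha^-}f(t)$ denote the right and left limits of $f$ at $\alpha$, and $E(X)=\int_a^b t f(t)\,dt$ is the expectation of $X$. *)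

theory Defs
  imports "HOL-Probability.Probability"
begin

definition right_lim :: "(real \<Rightarrow> real) \<Rightarrow> real \<Rightarrow> real" where
  "right_lim f x = Lim (at_right x) f"

definition left_lim :: "(real \<Rightarrow> real) \<Rightarrow> real \<Rightarrow> real" where
  "left_lim f x = Lim (at_left x) f"

text \<open>The density is a function on the closed interval from \<open>a\<close> to \<open>b\<close>; here it is a total function,
  restricted by the indicator, so that its values outside the interval are irrelevant.\<close>

definition rv_with_density ::
    "'m measure \<Rightarrow> ('m \<Rightarrow> real) \<Rightarrow> real \<Rightarrow> real \<Rightarrow> (real \<Rightarrow> real) \<Rightarrow> bool" where
  "rv_with_density M X a b f \<longleftrightarrow>
     prob_space M \<and> (\<forall>\<omega>\<in>space M. X \<omega> \<in> {a..b}) \<and>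
     (\<forall>t\<in>{a..b}. 0 \<le> f t) \<and>
     distributed M lborel X (\<lambda>t. ennreal (f t * indicator {a..b} t))"

lemma rv_with_density_expectation:
  assumes "rv_with_density M X a b f"
  shows "prob_space.expectation M X = (LINT t:{a..b}|lborel. t * f t)"
proof -
  have d: "distributed M lborel X (\<lambda>t. ennreal (f t * indicator {a..b} t))"
    and nn: "\<And>t. 0 \<le> f t * indicator {a..b} t"
    using assms by (auto simp: rv_with_density_def indicator_def)
  have "(LINT t|lborel. (f t * indicator {a..b} t) * t) = prob_space.expectation M X"
    by (rule distributed_integral[OF d]) (use nn in auto)
  then show ?thesis
    by (simp add: set_lebesgue_integral_def mult_ac)
qed

lemma tendsto_right_lim:
  assumes "mono_on {a..b} f" "a \<le> x" "x < b"
  shows "(f \<longlongrightarrow> right_lim f x) (at_right x)"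
proof -
  let ?l = "INF t\<in>{x<..<b}. f t"
  have ne: "{x<..<b} \<noteq> {}" using assms by auto
  have bdd: "bdd_below (f ` {x<..<b})"
    by (rule bdd_belowI[of _ "f x"]) (use assms in \<open>auto simp: mono_on_def\<close>)
  have "(f \<longlongrightarrow> ?l) (at_right x)"
  proof (rule order_tendstoI)
    fix y assume "y < ?l"
    then have "y < f t" if "t \<in> {x<..<b}" for t
      using cINF_lower[OF bdd that] by linarith
    then show "\<forall>\<^sub>F t in at_right x. y < f t"
      unfolding eventually_at_right[OF \<open>x < b\<close>] using \<open>x < b\<close> by auto
  next
    fix y assume "?l < y"
    then obtain s where s: "x < s" "s < b" "f s < y"
      using cINF_less_iff[OF ne bdd] by auto
    have "f t < y" if "x < t" "t < s" for t
    proof -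
      have "f t \<le> f s" using assms s that by (auto simp: mono_on_def)
      then show ?thesis using s by linarith
    qed
    then show "\<forall>\<^sub>F t in at_right x. f t < y"
      unfolding eventually_at_right[OF \<open>x < b\<close>] using s by auto
  qed
  then show ?thesis
    unfolding right_lim_def by (simp add: tendsto_Lim)
qed

lemma tendsto_left_lim:
  assumes "mono_on {a..b} f" "a < x" "x \<le> b"
  shows "(f \<longlongrightarrow> left_lim f x) (at_left x)"
proof -
  let ?l = "SUP t\<in>{a<..<x}. f t"
  have ne: "{a<..<x} \<noteq> {}" using assms by auto
  have bdd: "bdd_above (f ` {a<..<x})"
    by (rule bdd_aboveI[of _ "f x"]) (use assms in \<open>auto simp: mono_on_def\<close>)
  have "(f \<longlongrightarrow> ?l) (at_left x)"
  proof (rule order_tendstoI)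
    fix y assume "?l < y"
    then have "f t < y" if "t \<in> {a<..<x}" for t
      using cSUP_upper[OF that bdd] by linarith
    then show "\<forall>\<^sub>F t in at_left x. f t < y"
      unfolding eventually_at_left[OF \<open>a < x\<close>] using \<open>a < x\<close> by auto
  next
    fix y assume "y < ?l"
    then obtain s where s: "a < s" "s < x" "y < f s"
      using less_cSUP_iff[OF ne bdd] by auto
    have "y < f t" if "s < t" "t < x" for t
    proof -
      have "f s \<le> f t" using assms s that by (auto simp: mono_on_def)
      then show ?thesis using s by linarith
    qed
    then show "\<forall>\<^sub>F t in at_left x. y < f t"
      unfolding eventually_at_left[OF \<open>a < x\<close>] using s by auto
  qed
  then show ?thesis
    unfolding left_lim_def by (simp add: tendsto_Lim)
qed

end

theory Submission
  imports Defs
begin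

text \<open>Since \<open>E(X) - x\<close> is the integral of \<open>(t - x) f t\<close>, monotonicity lets one replace \<open>f\<close> on either side
  of \<open>x\<close> by its one-sided limits at \<open>x\<close> (lower bound) or at \<open>a\<close> and \<open>b\<close> (upper bound), because
  \<open>t - x\<close> has constant sign there. For the uniform distribution both bounds are equalities, and a constant
  \<open>c\<close> other than \<open>1/2\<close> changes the bound by \<open>(2 * c - 1) * ((a + b) / 2 - x)\<close>, whose sign is that of
  \<open>2 * c - 1\<close> as soon as \<open>x\<close> lies left of the midpoint.\<close>

text \<open>The values on the left neighbourhood from \<open>t\<close> to \<open>x\<close> all
  dominate \<open>f t\<close>, and the limit inherits this. Strictness of \<open>t < x\<close>
  matters: \<open>f\<close> may jump upwards at \<open>x\<close> itself.\<close>

lemma mono_on_le_left_lim: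
  assumes f: "mono_on {a..b} f" and t: "a \<le> t" "t < x" "x \<le> b"
  shows "f t \<le> left_lim f x"
proof (rule tendsto_lowerbound)
  show "(f \<longlongrightarrow> left_lim f x) (at_left x)"
    by (rule tendsto_left_lim[OF f le_less_trans[OF t(1,2)] t(3)])
  have "f t \<le> f s" if "t < s" "s < x" for s
    using t that by (intro mono_onD[OF f]) (meson atLeastAtMost_iff less_imp_le order_trans)+
  then show "\<forall>\<^sub>F s in at_left x. f t \<le> f s"
    unfolding eventually_at_left[OF \<open>t < x\<close>] using t(2) by blast
qed simp

lemma right_lim_le_mono_on:
  assumes f: "mono_on {a..b} f" and t: "a \<le> x" "x < t" "t \<le> b"
  shows "right_lim f x \<le> f t"
proof (rule tendsto_upperbound)
  show "(f \<longlongrightarrow> right_lim f x) (at_right x)"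
    by (rule tendsto_right_lim[OF f t(1) less_le_trans[OF t(2,3)]])
  have "f s \<le> f t" if "x < s" "s < t" for s
    using t that by (intro mono_onD[OF f]) (meson atLeastAtMost_iff less_imp_le order_trans)+
  then show "\<forall>\<^sub>F s in at_right x. f s \<le> f t"
    unfolding eventually_at_right[OF \<open>x < t\<close>] using t(2) by blast
qed simp

text \<open>Both bounds of the theorem are centered moments of a two-step function:
  \<open>p\<close>, \<open>q\<close> will be the one-sided limits at \<open>x\<close>, or those at
  \<open>a\<close> and \<open>b\<close>. The indicators overlap only at \<open>x\<close>, where the
  factor \<open>t - x\<close> vanishes.\<close>

lemma has_bochner_integral_step_moment:
  fixes a b x p q :: real
  assumes "a \<le> x" "x \<le> b"
  shows "has_bochner_integral lborel
    (\<lambda>t. (t - x) * p * indicator {a..x} t + (t - x) * q * indicator {x..b} t)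
    (1/2 * ((b - x)\<^sup>2 * q - (x - a)\<^sup>2 * p))"
proof -
  \<comment> \<open>The antiderivative \<open>(t - x)\<^sup>2 / 2 * r\<close> is zero at
    \<open>x\<close>, so each piece contributes only through its outer endpoint.\<close>
  have moment: "has_bochner_integral lborel (\<lambda>t. (t - x) * r * indicator {u..v} t)
      ((v - x)\<^sup>2 / 2 * r - (u - x)\<^sup>2 / 2 * r)" if "u \<le> v" for u v r :: real
    by (rule has_bochner_integral_FTC_Icc_real[OF that])
      (auto intro!: derivative_eq_intros continuous_intros)
  show ?thesis
    using has_bochner_integral_add[OF moment[OF assms(1), of p] moment[OF assms(2), of q]]
    by (simp add: power2_commute[of a x] algebra_simps)
qed

lemma rv_with_density_centered_moment:
  assumes "rv_with_density M X a b f"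
  shows "has_bochner_integral lborel (\<lambda>t. f t * indicator {a..b} t * (t - x))
    (prob_space.expectation M X - x)"
proof -
  have M: "prob_space M"
    and d: "distributed M lborel X (\<lambda>t. ennreal (f t * indicator {a..b} t))"
    and nn: "\<And>t. 0 \<le> f t * indicator {a..b} t"
    and X: "\<And>\<omega>. \<omega> \<in> space M \<Longrightarrow> X \<omega> \<in> {a..b}"
    using assms by (auto simp: rv_with_density_def indicator_def)
  have [measurable]: "X \<in> borel_measurable M"
    using distributed_measurable[OF d] by simp
  have fin: "finite_measure M"
    using M by (rule prob_space.finite_measure)
  have int: "integrable M X"
    by (rule finite_measure.integrable_const_bound[OF fin, where B = "max \<bar>a\<bar> \<bar>b\<bar>"])
      (use X in force)+
  have "(LINT t|lborel. f t * indicator {a..b} t * (t - x)) = prob_space.expectation M (\<lambda>\<omega>. X \<omega> - x)"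
    by (rule distributed_integral[OF d]) (use nn in auto)
  also have "\<dots> = prob_space.expectation M X - x"
    using int fin by (simp add: prob_space.prob_space[OF M] finite_measure.integrable_const)
  finally have "(LINT t|lborel. f t * indicator {a..b} t * (t - x)) = prob_space.expectation M X - x" .
  \<comment> \<open>Integrability needs its own argument: the integral of a non-integrable function
    is 0 by default, so the equation alone does not give
    \<open>has_bochner_integral\<close>.\<close>
  moreover have "integrable lborel (\<lambda>t. f t * indicator {a..b} t * (t - x))"
    using distributed_integrable[OF d, of "\<lambda>t. t - x"] int nn fin
    by (simp add: finite_measure.integrable_const)
  ultimately show ?thesis
    by (simp add: has_bochner_integral_iff)
qed

text \<open>Here \<open>r\<close> stands for \<open>f t\<close>. The factor \<open>t - x\<close> is
  negative on the left, which reverses the comparison with \<open>p\<close>, and positive on the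
  right. At \<open>t = x\<close> both sides are 0, so the value of \<open>f\<close> at a jump is
  harmless.\<close>

lemma step_moment_le:
  fixes a b p q r t x :: real
  assumes "a \<le> x" "x \<le> b"
    and left: "a \<le> t \<Longrightarrow> t < x \<Longrightarrow> r \<le> p" and right: "x < t \<Longrightarrow> t \<le> b \<Longrightarrow> q \<le> r"
  shows "(t - x) * p * indicator {a..x} t + (t - x) * q * indicator {x..b} t
    \<le> r * indicator {a..b} t * (t - x)"
proof (cases t x rule: linorder_cases)
  case less
  then have "t \<notin> {x..b}" and "t \<in> {a..x} \<longleftrightarrow> t \<in> {a..b}"
    using assms(2) by (meson atLeastAtMost_iff less_imp_le not_le order_trans)+
  moreover have "(t - x) * p \<le> (t - x) * r" if "t \<in> {a..b}"
  proof (rule mult_left_mono_neg)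
    show "r \<le> p" using left that less by (meson atLeastAtMost_iff)
    show "t - x \<le> 0" using less by (simp only: diff_le_0_iff_le less_imp_le)
  qed
  ultimately show ?thesis
    by (cases "t \<in> {a..b}") (simp_all add: mult.commute del: atLeastAtMost_iff)
next
  case greater
  then have "t \<notin> {a..x}" and "t \<in> {x..b} \<longleftrightarrow> t \<in> {a..b}"
    using assms(1) by (meson atLeastAtMost_iff less_imp_le not_le order_trans)+
  moreover have "(t - x) * q \<le> (t - x) * r" if "t \<in> {a..b}"
  proof (rule mult_left_mono)
    show "q \<le> r" using right that greater by (meson atLeastAtMost_iff)
    show "0 \<le> t - x" using greater by (simp only: diff_ge_0_iff_ge less_imp_le)
  qed
  ultimately show ?thesis
    by (cases "t \<in> {a..b}") (simp_all add: mult.commute del: atLeastAtMost_iff)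
qed simp

text \<open>Negating \<open>p\<close>, \<open>q\<close> and \<open>r\<close> turns this into
  \<open>step_moment_le\<close>.\<close>

lemma step_moment_ge:
  fixes a b p q r t x :: real
  assumes x: "a \<le> x" "x \<le> b"
    and left: "a \<le> t \<Longrightarrow> t < x \<Longrightarrow> p \<le> r" and right: "x < t \<Longrightarrow> t \<le> b \<Longrightarrow> r \<le> q"
  shows "r * indicator {a..b} t * (t - x)
    \<le> (t - x) * p * indicator {a..x} t + (t - x) * q * indicator {x..b} t"
proof -
  have "(t - x) * - p * indicator {a..x} t + (t - x) * - q * indicator {x..b} t
      \<le> - r * indicator {a..b} t * (t - x)"
    using x by (rule step_moment_le) (use left right in \<open>simp_all only: neg_le_iff_le\<close>)
  then show ?thesis
    by (simp only: mult_minus_left mult_minus_right minus_add_distrib[symmetric] neg_le_iff_le)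
qed

text \<open>The comparison with the limits at \<open>x\<close> holds at every \<open>t\<close>, so
  plain monotonicity of the integral is enough.\<close>

lemma expectation_lower_bound:
  assumes X: "rv_with_density M X a b f" and f: "mono_on {a..b} f" and x: "a < x" "x < b"
  shows "1/2 * ((b - x)\<^sup>2 * right_lim f x - (x - a)\<^sup>2 * left_lim f x) + x
    \<le> prob_space.expectation M X"
proof -
  note x' = less_imp_le[OF x(1)] less_imp_le[OF x(2)]
  note g = rv_with_density_centered_moment[OF X, of x]
  note h = has_bochner_integral_step_moment[OF x', of "left_lim f x" "right_lim f x"]
  have "1/2 * ((b - x)\<^sup>2 * right_lim f x - (x - a)\<^sup>2 * left_lim f x)
      \<le> prob_space.expectation M X - x"
    unfolding has_bochner_integral_integral_eq[OF g, symmetric]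
      has_bochner_integral_integral_eq[OF h, symmetric]
    by (rule integral_mono[OF integrable.intros[OF h] integrable.intros[OF g]
          step_moment_le[OF x' mono_on_le_left_lim[OF f _ _ x'(2)] right_lim_le_mono_on[OF f x'(1)]]])
  then show ?thesis
    by (simp only: le_diff_eq)
qed

lemma expectation_upper_bound:
  assumes X: "rv_with_density M X a b f" and f: "mono_on {a..b} f" and x: "a \<le> x" "x \<le> b"
  shows "prob_space.expectation M X
    \<le> 1/2 * ((b - x)\<^sup>2 * left_lim f b - (x - a)\<^sup>2 * right_lim f a) + x"
proof -
  note g = rv_with_density_centered_moment[OF X, of x]
  note h = has_bochner_integral_step_moment[OF x, of "right_lim f a" "left_lim f b"]
  \<comment> \<open>The endpoints are left out because \<open>f a\<close> may lie below
    \<open>right_lim f a\<close>, and \<open>f b\<close> above \<open>left_lim f b\<close>; as null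
    sets they do not affect the integral.\<close>
  have le: "f t * indicator {a..b} t * (t - x)
      \<le> (t - x) * right_lim f a * indicator {a..x} t + (t - x) * left_lim f b * indicator {x..b} t"
    if t: "t \<noteq> a" "t \<noteq> b" for t
  proof (rule step_moment_ge[OF x])
    show "right_lim f a \<le> f t" if "a \<le> t" "t < x"
    proof (rule right_lim_le_mono_on[OF f order_refl])
      show "a < t" using that(1) t(1) by (rule le_neq_trans[OF _ not_sym])
      show "t \<le> b" using that(2) x(2) by (rule less_imp_le[OF less_le_trans])
    qed
    show "f t \<le> left_lim f b" if "x < t" "t \<le> b"
    proof (rule mono_on_le_left_lim[OF f _ _ order_refl])
      show "a \<le> t" using x(1) that(1) by (rule less_imp_le[OF le_less_trans])
      show "t < b" using that(2) t(2) by (rule le_neq_trans)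
    qed
  qed
  have "prob_space.expectation M X - x
      \<le> 1/2 * ((b - x)\<^sup>2 * left_lim f b - (x - a)\<^sup>2 * right_lim f a)"
    unfolding has_bochner_integral_integral_eq[OF g, symmetric]
      has_bochner_integral_integral_eq[OF h, symmetric]
  proof (rule integral_mono_AE)
    show "AE t in lborel. f t * indicator {a..b} t * (t - x)
        \<le> (t - x) * right_lim f a * indicator {a..x} t + (t - x) * left_lim f b * indicator {x..b} t"
      using AE_lborel_singleton[of a] AE_lborel_singleton[of b]
      by eventually_elim (rule le)
  qed (rule integrable.intros[OF g] integrable.intros[OF h])+
  then show ?thesis
    by (simp only: diff_le_eq)
qed

text \<open>The uniform measure lives on the whole line, so its identity map has to be clamped to the
  interval; this only matters on a null set.\<close>

lemma rv_with_density_uniform: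
  fixes a b :: real
  assumes "a < b"
  shows "rv_with_density (uniform_measure lborel {a..b}) (\<lambda>t. max a (min b t)) a b
    (\<lambda>_. 1 / (b - a))"
proof -
  let ?U = "uniform_measure lborel {a..b}"
  have "distr ?U lborel (\<lambda>t. max a (min b t)) = distr ?U lborel (\<lambda>t. t)"
    by (rule distr_cong_AE)
      (auto intro: AE_uniform_measureI)
  also have "\<dots> = ?U"
    by (rule distr_id2) simp
  also have "\<dots> = density lborel (\<lambda>t. ennreal (1 / (b - a) * indicator {a..b} t))"
    unfolding uniform_measure_def using assms
    by (intro density_cong)
      (auto simp: indicator_def ennreal_1[symmetric] divide_ennreal simp del: ennreal_1)
  finally show ?thesis
    using assms prob_space_uniform_measure[of lborel "{a..b}"]
    by (auto simp: rv_with_density_def distributed_def)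
qed

lemma left_lim_const [simp]: "left_lim (\<lambda>_. k) x = k"
  by (simp add: left_lim_def tendsto_Lim)

lemma right_lim_const [simp]: "right_lim (\<lambda>_. k) x = k"
  by (simp add: right_lim_def tendsto_Lim)

text \<open>Written as the mean plus an error term, so that its distance from the expectation can be
  read off for any \<open>c\<close>.\<close>

lemma uniform_bound:
  fixes a b c x :: real
  assumes "a < b"
  shows "c * ((b - x)\<^sup>2 * (1 / (b - a)) - (x - a)\<^sup>2 * (1 / (b - a))) + x
    = (a + b) / 2 + (2 * c - 1) * ((a + b) / 2 - x)"
proof -
  define d where "d = (a + b) / 2 - x"
  have "(b - x)\<^sup>2 * (1 / (b - a)) - (x - a)\<^sup>2 * (1 / (b - a)) = a + b - 2 * x"
    using assms
    by (simp add: diff_divide_distrib[symmetric] nonzero_divide_eq_eq)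
      (simp add: power2_eq_square algebra_simps)
  also have "\<dots> = 2 * d"
    by (simp add: d_def)
  finally have "(b - x)\<^sup>2 * (1 / (b - a)) - (x - a)\<^sup>2 * (1 / (b - a)) = 2 * d" .
  moreover have "(a + b) / 2 = d + x"
    by (simp add: d_def)
  ultimately show ?thesis
    by (simp only:) (simp add: algebra_simps)
qed

text \<open>No integral is computed: the two bounds already proved coincide for the constant density
  and squeeze the expectation.\<close>

lemma expectation_uniform:
  fixes a b :: real
  assumes "a < b"
  shows "prob_space.expectation (uniform_measure lborel {a..b}) (\<lambda>t. max a (min b t)) = (a + b) / 2"
proof -
  let ?x = "(a + b) / 2"
  have x: "a < ?x" "?x < b" using assms by auto
  have "mono_on {a..b} (\<lambda>_. 1 / (b - a))" by (simp add: mono_on_def)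
  note bounds = expectation_lower_bound[OF rv_with_density_uniform[OF assms] this x]
    expectation_upper_bound[OF rv_with_density_uniform[OF assms] this less_imp_le[OF x(1)] less_imp_le[OF x(2)]]
  show ?thesis
    using bounds unfolding left_lim_const right_lim_const uniform_bound[OF assms] by simp
qed

theorem theorem8:
  fixes a b :: real
  assumes "a < b"
  shows
    "(\<forall>(M :: 'm measure) X f. rv_with_density M X a b f \<and> mono_on {a..b} f \<longrightarrow>
        (\<forall>x\<in>{a<..<b}.
           1/2 * ((b - x)\<^sup>2 * right_lim f x - (x - a)\<^sup>2 * left_lim f x) + x
             \<le> prob_space.expectation M X \<and>
           prob_space.expectation M X
             \<le> 1/2 * ((b - x)\<^sup>2 * left_lim f b - (x - a)\<^sup>2 * right_lim f a) + x) \<and>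
        (\<forall>x\<in>{a, b}.
           prob_space.expectation M X
             \<le> 1/2 * ((b - x)\<^sup>2 * left_lim f b - (x - a)\<^sup>2 * right_lim f a) + x)) \<and>
     (\<forall>c > 1/2. \<not> (\<forall>(M :: real measure) X f.
        rv_with_density M X a b f \<and> mono_on {a..b} f \<longrightarrow>
        (\<forall>x\<in>{a<..<b}.
           c * ((b - x)\<^sup>2 * right_lim f x - (x - a)\<^sup>2 * left_lim f x) + x
             \<le> prob_space.expectation M X))) \<and>
     (\<forall>c < 1/2. \<not> (\<forall>(M :: real measure) X f.
        rv_with_density M X a b f \<and> mono_on {a..b} f \<longrightarrow>
        (\<forall>x\<in>{a<..<b}.
           prob_space.expectation M X
             \<le> c * ((b - x)\<^sup>2 * left_lim f b - (x - a)\<^sup>2 * right_lim f a) + x)))"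
proof (intro conjI allI impI ballI notI)
  fix M :: "'m measure" and X f x
  assume Xf: "rv_with_density M X a b f \<and> mono_on {a..b} f"
  note X = conjunct1[OF Xf] and f = conjunct2[OF Xf]
  show "1/2 * ((b - x)\<^sup>2 * right_lim f x - (x - a)\<^sup>2 * left_lim f x) + x
      \<le> prob_space.expectation M X" if "x \<in> {a<..<b}"
    using that unfolding greaterThanLessThan_iff by (blast intro: expectation_lower_bound[OF X f])
  show "prob_space.expectation M X
      \<le> 1/2 * ((b - x)\<^sup>2 * left_lim f b - (x - a)\<^sup>2 * right_lim f a) + x" if "x \<in> {a<..<b}"
    using that unfolding greaterThanLessThan_iff
    by (blast intro: expectation_upper_bound[OF X f] less_imp_le)
  show "prob_space.expectation M X
      \<le> 1/2 * ((b - x)\<^sup>2 * left_lim f b - (x - a)\<^sup>2 * right_lim f a) + x" if "x \<in> {a, b}"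
    using that assms by (blast intro: expectation_upper_bound[OF X f] less_imp_le)
next
  \<comment> \<open>One point left of the midpoint refutes both kinds of constant.\<close>
  obtain x where x: "a < x" "x < (a + b) / 2"
    using dense[of a "(a + b) / 2"] assms by auto
  have x': "x \<in> {a<..<b}"
    using x assms by simp
  have U: "rv_with_density (uniform_measure lborel {a..b}) (\<lambda>t. max a (min b t)) a b
      (\<lambda>_. 1 / (b - a)) \<and> mono_on {a..b} (\<lambda>_. 1 / (b - a))"
    using rv_with_density_uniform[OF assms] by (simp add: mono_on_def)
  \<comment> \<open>After cancelling the mean, only the sign of a product remains; splitting it into
    the signs of its factors makes the goal linear.\<close>
  note bound = uniform_bound[OF assms] expectation_uniform[OF assms] left_lim_const right_lim_const
    add_le_same_cancel1 le_add_same_cancel1 mult_le_0_iff zero_le_mult_iff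
  fix c :: real
  {
    assume c: "1/2 < c" and "\<forall>(M :: real measure) X f.
        rv_with_density M X a b f \<and> mono_on {a..b} f \<longrightarrow>
        (\<forall>x\<in>{a<..<b}.
           c * ((b - x)\<^sup>2 * right_lim f x - (x - a)\<^sup>2 * left_lim f x) + x
             \<le> prob_space.expectation M X)"
    from this(2)[rule_format, OF U x'] show False
      unfolding bound using c x(2) by linarith
  next
    assume c: "c < 1/2" and "\<forall>(M :: real measure) X f.
        rv_with_density M X a b f \<and> mono_on {a..b} f \<longrightarrow>
        (\<forall>x\<in>{a<..<b}.
           prob_space.expectation M X
             \<le> c * ((b - x)\<^sup>2 * left_lim f b - (x - a)\<^sup>2 * right_lim f a) + x)"
    from this(2)[rule_format, OF U x'] show False
      unfolding bound using c x(2) by linarith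
  }
qed

end
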